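(* Let $\phi$ be a gauge (not necessarily continuous). Let $X=\mathbb R^m$ for some integer $m\geq1$, or $X=\omega^\omega$. If $E\subseteq X$ and $\mathscr H^\phi(E)=0$, then there is $s\in\mathbb S$ such that $\phi\circ s\in\ell^1$ (i.e. $\sum_{n\geq1}\phi(s_n)<\infty$) and $E$ is $\overline s$-dominated. In other words, $$\mathcal N(\mathscr H^\phi)=\bigcup\{\mathcal D_X(\overline s): s\in\mathbb S,\ \phi\circ s\in\ell^1\}.$$
   Context: $\mathbb S$ is the set of all strictly decreasing sequences $s=(s_n)_{n\geq1}$ of positive reals converging to $0$. For $s\in\mathbb S$ and $k\geq1$ let $s^{\times k}=(s_{kn})_{n\geq1}$, and let $\overline s=\{s^{\times k}:k\geq1\}$. For $S\subseteq\mathbb S$ and a separable metric space $X$, a set $E\subseteq X$ is $S$-dominated if for each $t\in S$ there is a sequence $(E_n)_{n\geq1}$ of subsets of $X$ that covers $E$ and satisfies $\operatorname{diam}E_n<t_n$ for all $n$; $\mathcal D_X(S)$ is the family of all $S$-dominated subsets of $X$. A gauge is a non-decreasing right-continuous function $\phi\colon[0,\infty)\to[0,\infty)$ with $\phi(0)=0$ and $\phi(r)>0$ for $r>0$. The Hausdorff measure on $X$ is $\mathscr H^\phi(E)=\sup_{\delta>0}\inf\{\sum_n\phi(\operatorname{diam}E_n):\{E_n\}\text{ a countable cover of }E\text{ by subsets of }X\text{ with }\operatorname{diam}E_n<\delta\text{ for all }n\}$, and $\mathcal N(\mathscr H^\phi)=\{E\subseteq X:\mathscr H^\phi(E)=0\}$.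 $\omega=\{0,1,2,\dots\}$ and $\omega^\omega$ is the space of all sequences $x\colon\omega\to\omega$ with the metric $d(x,y)=2^{-n}$ for $x\neq y$, where $n$ is the first index with $x(n)\neq y(n)$. $\mathbb R^m$ carries its usual metric. *)

theory Defs
  imports "HOL-Analysis.Analysis"
begin

text \<open>Sequences \<open>(s\<^sub>n)\<close> with \<open>n \<ge> 1\<close> are functions on \<^typ>\<open>nat\<close> whose value at \<open>0\<close> is
  irrelevant and is never inspected below.\<close>

definition null_seqs :: "(nat \<Rightarrow> real) set" where
  "null_seqs = {s. (\<forall>n\<ge>1. 0 < s n) \<and> strict_antimono_on {1..} s \<and> s \<longlonglongrightarrow> 0}"

definition dilate :: "(nat \<Rightarrow> real) \<Rightarrow> nat \<Rightarrow> nat \<Rightarrow> real" where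
  "dilate s k = (\<lambda>n. s (k * n))"

definition dilates :: "(nat \<Rightarrow> real) \<Rightarrow> (nat \<Rightarrow> real) set" where
  "dilates s = {dilate s k |k. k \<ge> 1}"

text \<open>The real-valued \<^const>\<open>diameter\<close> is unspecified on unbounded sets, whose diameter is
  \<open>\<infinity>\<close>; hence \<open>diam A < r\<close> is rendered as boundedness together with the inequality.\<close>

definition dominated :: "(nat \<Rightarrow> real) set \<Rightarrow> 'a::metric_space set \<Rightarrow> bool" where
  "dominated S E \<longleftrightarrow> (\<forall>t\<in>S. \<exists>F :: nat \<Rightarrow> 'a set.
     E \<subseteq> (\<Union>n\<in>{1..}. F n) \<and> (\<forall>n\<ge>1. bounded (F n) \<and> diameter (F n) < t n))"

definition dominated_sets :: "(nat \<Rightarrow> real) set \<Rightarrow> 'a::metric_space set set" where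
  "dominated_sets S = {E. dominated S E}"

text \<open>A gauge is a function on \<open>[0,\<infinity>)\<close>; its values at negative reals are irrelevant.\<close>

definition hausdorff_gauge :: "(real \<Rightarrow> real) \<Rightarrow> bool" where
  "hausdorff_gauge \<phi> \<longleftrightarrow> mono_on {0..} \<phi> \<and> (\<forall>r\<ge>0. continuous (at_right r) \<phi>)
     \<and> \<phi> 0 = 0 \<and> (\<forall>r>0. \<phi> r > 0)"

text \<open>Finite covers are included, since they can be padded with \<open>{}\<close> and
  \<open>\<phi> (diameter {}) = \<phi> 0 = 0\<close>.\<close>

definition hausdorff_measure :: "(real \<Rightarrow> real) \<Rightarrow> 'a::metric_space set \<Rightarrow> ennreal" where
  "hausdorff_measure \<phi> E =
     (SUP \<delta>\<in>{0<..}.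
        INF C\<in>{C :: nat \<Rightarrow> 'a set. E \<subseteq> (\<Union>n. C n) \<and> (\<forall>n. bounded (C n) \<and> diameter (C n) < \<delta>)}.
          (\<Sum>n. ennreal (\<phi> (diameter (C n)))))"

definition hausdorff_null :: "(real \<Rightarrow> real) \<Rightarrow> 'a::metric_space set set" where
  "hausdorff_null \<phi> = {E. hausdorff_measure \<phi> E = 0}"

text \<open>A copy of \<^typ>\<open>nat \<Rightarrow> nat\<close> is needed because the library metric on function spaces is a
  weighted sum, which yields a different metric.\<close>

typedef baire = "UNIV :: (nat \<Rightarrow> nat) set"
  morphisms baire_nth Abs_baire ..

instantiation baire :: metric_space
begin

definition dist_baire :: "baire \<Rightarrow> baire \<Rightarrow> real" where
  "dist_baire x y =
     (if x = y then 0 else (1 / 2) ^ (LEAST n. baire_nth x n \<noteq> baire_nth y n))"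

definition uniformity_baire :: "(baire \<times> baire) filter" where
  "uniformity_baire = (INF e\<in>{0<..}. principal {(x, y). dist x y < e})"

definition open_baire :: "baire set \<Rightarrow> bool" where
  "open_baire U \<longleftrightarrow> (\<forall>x\<in>U. eventually (\<lambda>(x', y). x' = x \<longrightarrow> y \<in> U) uniformity)"

instance
proof
  fix x y z :: baire
  show "dist x y = 0 \<longleftrightarrow> x = y" by (simp add: dist_baire_def)
  show "dist x y \<le> dist x z + dist y z"
  proof (cases "x = y \<or> x = z \<or> y = z")
    case True
    moreover have "(\<lambda>n. baire_nth y n \<noteq> baire_nth z n) = (\<lambda>n. baire_nth z n \<noteq> baire_nth y n)"
      by metis
    ultimately show ?thesis unfolding dist_baire_def by (elim disjE) simp_all
  next
    case False
    define L where "L = (\<lambda>u v. LEAST n. baire_nth u n \<noteq> baire_nth v n)"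
    have "\<exists>n. baire_nth x n \<noteq> baire_nth y n"
      using False baire_nth_inject[of x y] by (metis ext)
    then have "baire_nth x (L x y) \<noteq> baire_nth y (L x y)"
      unfolding L_def by (rule LeastI_ex)
    then have "baire_nth x (L x y) \<noteq> baire_nth z (L x y) \<or>
        baire_nth y (L x y) \<noteq> baire_nth z (L x y)" by auto
    then have "L x z \<le> L x y \<or> L y z \<le> L x y"
      unfolding L_def by (auto intro: Least_le)
    then have "(1 / 2 :: real) ^ L x y \<le> (1 / 2) ^ L x z \<or>
        (1 / 2 :: real) ^ L x y \<le> (1 / 2) ^ L y z"
      by (auto intro: power_decreasing)
    moreover have "(0::real) \<le> (1 / 2) ^ L x z" "(0::real) \<le> (1 / 2) ^ L y z" by simp_all
    ultimately have "(1 / 2 :: real) ^ L x y \<le> (1 / 2) ^ L x z + (1 / 2) ^ L y z"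
      by linarith
    then show ?thesis using False unfolding dist_baire_def L_def by simp
  qed
qed (rule uniformity_baire_def open_baire_def)+

end

end

theory Submission
  imports Defs
begin

text \<open>
  The argument works in every metric space. Domination by the dilates of a sequence \<open>s\<close> with
  \<open>\<phi> \<circ> s \<in> \<ell>\<^sup>1\<close> forces measure zero because \<open>\<phi> \<circ> s\<close> is decreasing: each term of the dilate
  \<open>\<phi> (s (k * n))\<close> is at most the average of the \<open>k\<close> terms that end at it, so the dilated series
  has sum at most \<open>1 / k\<close> times that of \<open>\<phi> \<circ> s\<close>.

  Conversely, let \<open>E\<close> be null and choose for each \<open>k \<ge> 1\<close> a countable cover of \<open>E\<close> whose
  \<open>\<phi>\<close>-sum is at most \<open>2\<^sup>1\<^sup>-\<^sup>k / k\<close>. The diameters of all these covers, those of the \<open>k\<close>-th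
  cover being listed \<open>k\<close> times each, still form a family with summable \<open>\<phi>\<close>-values. Right
  continuity of \<open>\<phi>\<close> lets each of them be increased a little, keeping the family summable, so that
  they become positive and pairwise distinct. Summability leaves only finitely many of them above
  any positive bound, since \<open>\<phi>\<close> is bounded away from \<open>0\<close> there; hence they can be listed in
  decreasing order, and this list is \<open>s\<close> (\<open>decreasing_rearrangement\<close>). Now fix \<open>k\<close>. Each
  set of the \<open>k\<close>-th cover owns \<open>k\<close> places of the list, all with values above its diameter. Order
  the sets of this cover by the last place they own. The first \<open>n\<close> of them own \<open>k * n\<close> places
  altogether, so the last place of the \<open>n\<close>-th set comes at or after place \<open>k * n\<close>, and
  its diameter is below \<open>s (k * n)\<close> (\<open>dominated_by_blocks\<close>).
\<close>

section \<open>Rearranging a null sequence in decreasing order\<close>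

text \<open>A value is moved to the place given by the number of larger values. The places that are used
  form an infinite initial segment of the natural numbers: the smallest of the \<open>n + 1\<close> values
  above the value at place \<open>n + 1\<close> is at place \<open>n\<close>.\<close>

lemma decreasing_rearrangement:
  fixes a :: "nat \<Rightarrow> real"
  assumes inj: "inj a" and pos: "\<And>n. 0 < a n" and lim: "a \<longlonglongrightarrow> 0"
  obtains \<sigma> :: "nat \<Rightarrow> nat" where "bij \<sigma>" "strict_antimono_on UNIV (a \<circ> \<sigma>)"
proof -
  define above where "above = (\<lambda>q. {q'. a q < a q'})"
  define rank where "rank = (\<lambda>q. card (above q))"
  have fin: "finite (above q)" for q
  proof -
    have "eventually (\<lambda>n. a n < a q) sequentially"
      using lim pos order_tendstoD(2) by blast
    then obtain N where "\<And>n. n \<ge> N \<Longrightarrow> a n < a q"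
      by (auto simp: eventually_sequentially)
    then have "above q \<subseteq> {..<N}"
      unfolding above_def by (force simp: not_le[symmetric])
    then show ?thesis by (rule finite_subset) simp
  qed
  have rank_less: "rank q' < rank q" if "a q < a q'" for q q'
  proof -
    have "above q' \<subset> above q" using that unfolding above_def by auto
    then show ?thesis unfolding rank_def using fin by (simp add: psubset_card_mono)
  qed
  have rank_inj: "inj rank"
  proof (rule injI)
    fix q q' assume "rank q = rank q'"
    then have "a q = a q'" using rank_less by (metis less_irrefl linorder_neqE)
    then show "q = q'" using inj by (simp add: inj_eq)
  qed
  have down: "n \<in> range rank" if "Suc n \<in> range rank" for n
  proof -
    from that obtain q where q: "rank q = Suc n" by auto
    then have ne: "above q \<noteq> {}" unfolding rank_def by auto
    define v where "v = Min (a ` above q)"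
    have "v \<in> a ` above q" unfolding v_def using ne fin by (intro Min_in) auto
    then obtain q' where q': "q' \<in> above q" "a q' = v" by auto
    have min: "a q' \<le> a p" if "p \<in> above q" for p
      unfolding q' v_def using fin that by auto
    have "above q' = above q - {q'}"
      using q' min inj unfolding above_def by (auto simp: less_le inj_eq)
    then have "rank q' = n" using q q' fin unfolding rank_def by simp
    then show ?thesis by auto
  qed
  have down': "m \<in> range rank" if "n \<in> range rank" "m \<le> n" for m n
    using that(2,1) by (induction rule: inc_induct) (use down in auto)
  have "surj rank"
  proof -
    have "infinite (range rank)" using rank_inj by (simp add: finite_image_iff)
    then show ?thesis using down' by (metis UNIV_eq_I infinite_nat_iff_unbounded_le)
  qed
  with rank_inj have bij: "bij rank" by (simp add: bij_def)
  show thesis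
  proof
    show "bij (inv rank)" using bij by (rule bij_imp_bij_inv)
    show "strict_antimono_on UNIV (a \<circ> inv rank)"
    proof (rule monotone_onI, simp)
      fix m n :: nat assume "m < n"
      moreover have "rank (inv rank m) = m" "rank (inv rank n) = n"
        using bij by (simp_all add: bij_is_surj surj_f_inv_f)
      ultimately have ranks: "rank (inv rank m) < rank (inv rank n)" by simp
      then have "a (inv rank m) \<noteq> a (inv rank n)" using inj by (auto simp: inj_eq)
      moreover have "\<not> a (inv rank m) < a (inv rank n)"
        using ranks rank_less[of "inv rank m" "inv rank n"] by linarith
      ultimately show "a (inv rank n) < a (inv rank m)" by linarith
    qed
  qed
qed

text \<open>Each infinite set still contains a point outside the finitely many chosen before.\<close>

lemma injective_choice:
  fixes U :: "nat \<Rightarrow> 'a set"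
  assumes "\<And>n. infinite (U n)"
  obtains f where "inj f" "\<And>n. f n \<in> U n"
proof -
  have "\<exists>f. \<forall>n. f n \<in> U n \<and> f n \<notin> f ` {..<n}"
  proof (rule dependent_wellorder_choice)
    fix n :: nat and f :: "nat \<Rightarrow> 'a"
    show "\<exists>r. r \<in> U n \<and> r \<notin> f ` {..<n}"
      using assms[of n] by (meson finite_imageI finite_lessThan finite_subset subsetI)
  qed (auto simp: image_iff)
  then obtain f where f: "\<And>n. f n \<in> U n" "\<And>n. f n \<notin> f ` {..<n}" by blast
  have "inj f"
  proof (rule linorder_injI)
    fix m n :: nat assume "m < n"
    then have "f m \<in> f ` {..<n}" by simp
    then show "f m \<noteq> f n" using f(2)[of n] by metis
  qed
  with f(1) show thesis by (rule that[rotated])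
qed

section \<open>Domination from places in a list\<close>

text \<open>The \<open>m\<close>-th set owns the places \<open>Q (m * k + i)\<close> with \<open>i < k\<close>. Ranking the sets by their
  last places sends them injectively to positive integers. Places are counted from \<open>0\<close> and the
  terms of \<open>t\<close> from \<open>1\<close>, so place \<open>p\<close> carries the value \<open>t (Suc p)\<close>.\<close>

lemma dominated_by_blocks:
  fixes C :: "nat \<Rightarrow> 'a::metric_space set" and Q :: "nat \<Rightarrow> nat"
  assumes k: "k \<ge> 1" and inj: "inj Q"
    and t: "\<And>m n. 1 \<le> m \<Longrightarrow> m \<le> n \<Longrightarrow> t n \<le> t m" and tpos: "\<And>n. 1 \<le> n \<Longrightarrow> 0 < t n"
    and bdd: "\<And>m. bounded (C m)"
    and less: "\<And>m i. i < k \<Longrightarrow> diameter (C m) < t (Suc (Q (m * k + i)))"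
  obtains F where "(\<Union>m. C m) \<subseteq> (\<Union>n\<in>{1..}. F n)"
    "\<And>n. n \<ge> 1 \<Longrightarrow> bounded (F n) \<and> diameter (F n) < t (k * n)"
proof -
  define P where "P = (\<lambda>m. Max ((\<lambda>i. Q (m * k + i)) ` {..<k}))"
  have P_in: "\<exists>i<k. P m = Q (m * k + i)" for m
  proof -
    have "P m \<in> (\<lambda>i. Q (m * k + i)) ` {..<k}"
      unfolding P_def using k by (intro Max_in) (auto simp: lessThan_empty_iff)
    then show ?thesis by auto
  qed
  have P_ge: "Q (m * k + i) \<le> P m" if "i < k" for m i
    unfolding P_def using that by (intro Max_ge) auto
  have block: "(m * k + i) div k = m" if "i < k" for m i
    using that by simp
  have P_inj: "inj P"
    by (rule injI) (metis P_in block inj injD)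
  define before where "before = (\<lambda>m. {m'. P m' \<le> P m})"
  define r where "r = (\<lambda>m. card (before m))"
  have fin: "finite (before m)" for m
  proof -
    have "before m = P -` {..P m}" unfolding before_def by auto
    then show ?thesis using finite_vimageI[OF _ P_inj] by simp
  qed
  have r_ge: "r m \<ge> 1" for m
  proof -
    have "m \<in> before m" unfolding before_def by simp
    then show ?thesis unfolding r_def using fin by (metis One_nat_def Suc_leI card_gt_0_iff empty_iff)
  qed
  have r_less: "r m' < r m" if "P m' < P m" for m m'
  proof -
    have "before m' \<subset> before m" using that unfolding before_def by force
    then show ?thesis unfolding r_def using fin by (simp add: psubset_card_mono)
  qed
  have r_inj: "inj r"
    by (rule injI) (metis P_inj injD less_irrefl linorder_neqE r_less)
  have r_le: "k * r m \<le> Suc (P m)" for m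
  proof -
    define g where "g = (\<lambda>(m', i). Q (m' * k + i))"
    have "inj_on g (before m \<times> {..<k})"
    proof (rule inj_onI, clarsimp simp: g_def)
      fix x i y j assume *: "i < k" "j < k" "Q (x * k + i) = Q (y * k + j)"
      then have eq: "x * k + i = y * k + j" using inj by (simp add: inj_eq)
      then have "x = y" using block[OF *(1), of x] block[OF *(2), of y] by metis
      with eq show "x = y \<and> i = j" by simp
    qed
    moreover have "g ` (before m \<times> {..<k}) \<subseteq> {..P m}"
      unfolding g_def before_def by (auto intro: order_trans[OF P_ge])
    ultimately have "card (before m \<times> {..<k}) \<le> card {..P m}"
      by (intro card_inj_on_le) auto
    then show ?thesis by (simp add: r_def card_cartesian_product mult.commute)
  qed
  define F where "F = (\<lambda>n. if n \<in> range r then C (inv r n) else {})"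
  have F_r: "F (r m) = C m" for m
    unfolding F_def using r_inj by simp
  have "diameter (C m) < t (k * r m)" for m
  proof -
    obtain i where i: "i < k" "P m = Q (m * k + i)" using P_in by blast
    have "1 \<le> k * r m" using k r_ge[of m] by (metis mult_le_mono mult_1)
    then show ?thesis using less[OF i(1), of m] t[OF _ r_le, of m] i(2) by auto
  qed
  then have F_r_less: "bounded (F (r m)) \<and> diameter (F (r m)) < t (k * r m)" for m
    using bdd F_r by metis
  show thesis
  proof
    show "(\<Union>m. C m) \<subseteq> (\<Union>n\<in>{1..}. F n)"
    proof
      fix x assume "x \<in> (\<Union>m. C m)"
      then obtain m where "x \<in> F (r m)" using F_r by auto
      then show "x \<in> (\<Union>n\<in>{1..}. F n)" using r_ge[of m] by auto
    qed
    fix n :: nat assume n: "n \<ge> 1"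
    show "bounded (F n) \<and> diameter (F n) < t (k * n)"
    proof (cases "n \<in> range r")
      case True then show ?thesis using F_r_less by auto
    next
      case False
      have "1 \<le> k * n" using k n by (metis mult_le_mono mult_1)
      with False show ?thesis using tpos by (simp add: F_def diameter_def)
    qed
  qed
qed

section \<open>Gauges and covers with small sums\<close>

lemma gauge_mono: "hausdorff_gauge \<phi> \<Longrightarrow> 0 \<le> x \<Longrightarrow> x \<le> y \<Longrightarrow> \<phi> x \<le> \<phi> y"
  by (auto simp: hausdorff_gauge_def mono_on_def)

lemma gauge_nonneg: "hausdorff_gauge \<phi> \<Longrightarrow> 0 \<le> x \<Longrightarrow> 0 \<le> \<phi> x"
  using gauge_mono[of \<phi> 0 x] by (simp add: hausdorff_gauge_def)

lemma gauge_increase: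
  assumes "hausdorff_gauge \<phi>" "0 \<le> d" "0 < e"
  obtains u where "d < u" "\<And>x. d < x \<Longrightarrow> x < u \<Longrightarrow> \<phi> x < \<phi> d + e"
proof -
  have "(\<phi> \<longlongrightarrow> \<phi> d) (at_right d)"
    using assms by (auto simp: hausdorff_gauge_def continuous_within)
  then have "eventually (\<lambda>x. \<phi> x < \<phi> d + e) (at_right d)"
    using assms(3) by (intro order_tendstoD) auto
  then show thesis using that unfolding eventually_at_right_field by blast
qed

lemma gauge_summable_imp_null:
  assumes g: "hausdorff_gauge \<phi>" and pos: "\<And>n. 0 < a n" and sum: "summable (\<lambda>n. \<phi> (a n))"
  shows "a \<longlonglongrightarrow> 0"
proof (rule order_tendstoI)
  fix e :: real assume e: "0 < e"
  then have "0 < \<phi> e" using g by (simp add: hausdorff_gauge_def)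
  then have "eventually (\<lambda>n. \<phi> (a n) < \<phi> e) sequentially"
    using summable_LIMSEQ_zero[OF sum] order_tendstoD(2) by blast
  then show "eventually (\<lambda>n. a n < e) sequentially"
    by eventually_elim (metis e g gauge_mono less_eq_real_def not_le)
next
  fix e :: real assume "e < 0"
  then show "eventually (\<lambda>n. e < a n) sequentially"
    using pos by (auto intro: always_eventually less_trans)
qed

text \<open>Covers of any one fineness already have arbitrarily small \<open>\<phi>\<close>-sums, because the
  infimum for a fixed \<open>\<delta>\<close> is at most the supremum over all \<open>\<delta>\<close>, which is \<open>0\<close>.\<close>

lemma null_set_cover:
  fixes E :: "'a::metric_space set"
  assumes g: "hausdorff_gauge \<phi>" and null: "hausdorff_measure \<phi> E = 0" and e: "0 < e"
  obtains C :: "nat \<Rightarrow> 'a set" where "E \<subseteq> (\<Union>n. C n)" "\<And>n. bounded (C n)"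
    "\<And>N. (\<Sum>n<N. \<phi> (diameter (C n))) \<le> e"
proof -
  define \<C> where "\<C> = {C :: nat \<Rightarrow> 'a set. E \<subseteq> (\<Union>n. C n) \<and>
    (\<forall>n. bounded (C n) \<and> diameter (C n) < 1)}"
  have "(INF C\<in>\<C>. (\<Sum>n. ennreal (\<phi> (diameter (C n))))) \<le> hausdorff_measure \<phi> E"
    unfolding hausdorff_measure_def \<C>_def by (rule SUP_upper2[of 1]) auto
  also have "\<dots> < ennreal e" using null e by simp
  finally obtain C where C: "C \<in> \<C>" "(\<Sum>n. ennreal (\<phi> (diameter (C n)))) < ennreal e"
    by (auto simp: INF_less_iff)
  have bdd: "bounded (C n)" for n using C(1) by (auto simp: \<C>_def)
  have "(\<Sum>n<N. \<phi> (diameter (C n))) \<le> e" for N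
  proof -
    have "ennreal (\<Sum>n<N. \<phi> (diameter (C n))) = (\<Sum>n<N. ennreal (\<phi> (diameter (C n))))"
      using g bdd by (intro sum_ennreal[symmetric]) (auto intro: gauge_nonneg diameter_ge_0)
    also have "\<dots> \<le> (\<Sum>n. ennreal (\<phi> (diameter (C n))))"
      by (rule sum_le_suminf) auto
    also have "\<dots> \<le> ennreal e" using C(2) by simp
    finally show ?thesis using e by simp
  qed
  then show thesis using that C(1) bdd by (auto simp: \<C>_def)
qed

text \<open>The family of all terms of all sequences \<open>b j\<close>, each term of \<open>b j\<close> repeated \<open>j + 1\<close>
  times, is summable because the factor \<open>j + 1\<close> is absorbed by the bound on the partial sums.\<close>

lemma summable_repeated_merge:
  fixes b :: "nat \<Rightarrow> nat \<Rightarrow> real"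
  assumes nonneg: "\<And>j n. 0 \<le> b j n"
    and le: "\<And>j N. (\<Sum>n<N. b j n) \<le> (1 / 2) ^ j / real (Suc j)"
  shows "summable (\<lambda>q. case prod_decode q of (j, p) \<Rightarrow> b j (p div Suc j))"
proof (rule summableI_nonneg_bounded)
  define f where "f = (\<lambda>(j, p). b j (p div Suc j))"
  have f_nonneg: "0 \<le> f x" for x unfolding f_def using nonneg by (auto split: prod.split)
  show "0 \<le> (case prod_decode q of (j, p) \<Rightarrow> b j (p div Suc j))" for q
    using nonneg by (auto split: prod.split)
  have row: "(\<Sum>p<N. f (j, p)) \<le> (1 / 2) ^ j" for j N
  proof -
    have "(\<Sum>p<N. f (j, p)) \<le> (\<Sum>p<N * Suc j. f (j, p))"
      using f_nonneg by (intro sum_mono2) auto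
    also have "\<dots> = (\<Sum>m<N. \<Sum>p\<in>{m * Suc j..<m * Suc j + Suc j}. f (j, p))"
      by (rule sum.nat_group[symmetric])
    also have "\<dots> = (\<Sum>m<N. \<Sum>p\<in>{m * Suc j..<m * Suc j + Suc j}. b j m)"
    proof (intro sum.cong refl)
      fix m p assume "p \<in> {m * Suc j..<m * Suc j + Suc j}"
      then have "p div Suc j = m" by (intro div_nat_eqI) (auto simp: mult.commute)
      then show "f (j, p) = b j m" by (simp add: f_def)
    qed
    also have "\<dots> = real (Suc j) * (\<Sum>m<N. b j m)" by (simp add: sum_distrib_left)
    also have "\<dots> \<le> real (Suc j) * ((1 / 2) ^ j / real (Suc j))"
      by (intro mult_left_mono le) simp
    also have "\<dots> = (1 / 2) ^ j" by simp
    finally show ?thesis .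
  qed
  fix N :: nat
  have "(\<Sum>q<N. case prod_decode q of (j, p) \<Rightarrow> b j (p div Suc j)) = (\<Sum>q<N. f (prod_decode q))"
    by (simp add: f_def)
  also have "\<dots> = sum f (prod_decode ` {..<N})"
    by (subst sum.reindex) (auto intro: inj_prod_decode)
  also have "\<dots> \<le> sum f ({..<N} \<times> {..<N})"
  proof (rule sum_mono2)
    show "prod_decode ` {..<N} \<subseteq> {..<N} \<times> {..<N}"
    proof clarify
      fix q j p assume "q < N" "(j, p) = prod_decode q"
      then show "j \<in> {..<N} \<and> p \<in> {..<N}"
        by (metis le_prod_encode_1 le_prod_encode_2 lessThan_iff order_le_less_trans
            prod_decode_inverse)
    qed
  qed (use f_nonneg in auto)
  also have "\<dots> = (\<Sum>j<N. \<Sum>p<N. f (j, p))"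
    by (simp add: sum.cartesian_product)
  also have "\<dots> \<le> (\<Sum>j<N. (1 / 2) ^ j)" by (intro sum_mono row)
  also have "\<dots> \<le> (\<Sum>j. (1 / 2 :: real) ^ j)"
    by (intro sum_le_suminf summable_geometric) auto
  finally show "(\<Sum>q<N. case prod_decode q of (j, p) \<Rightarrow> b j (p div Suc j)) \<le> (\<Sum>j. (1 / 2 :: real) ^ j)" .
qed

section \<open>Null sets are dominated\<close>

lemma hausdorff_null_imp_dominated:
  fixes E :: "'a::metric_space set"
  assumes g: "hausdorff_gauge \<phi>" and null: "hausdorff_measure \<phi> E = 0"
  shows "\<exists>s\<in>null_seqs. summable (\<lambda>n. \<phi> (s (Suc n))) \<and> dominated (dilates s) E"
proof -
  have "\<exists>C :: nat \<Rightarrow> 'a set. E \<subseteq> (\<Union>n. C n) \<and> (\<forall>n. bounded (C n)) \<and>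
      (\<forall>N. (\<Sum>n<N. \<phi> (diameter (C n))) \<le> (1 / 2) ^ j / real (Suc j))" for j :: nat
    by (rule null_set_cover[OF g null, of "(1 / 2) ^ j / real (Suc j)"]) auto
  then obtain C :: "nat \<Rightarrow> nat \<Rightarrow> 'a set" where C: "\<And>j. E \<subseteq> (\<Union>n. C j n)" "\<And>j n. bounded (C j n)"
    "\<And>j N. (\<Sum>n<N. \<phi> (diameter (C j n))) \<le> (1 / 2) ^ j / real (Suc j)"
    by metis
  define d where "d = (\<lambda>q. case prod_decode q of (j, p) \<Rightarrow> diameter (C j (p div Suc j)))"
  have d_nonneg: "0 \<le> d q" for q
    unfolding d_def using C(2) by (auto split: prod.split intro: diameter_ge_0)
  have "summable (\<lambda>q. case prod_decode q of (j, p) \<Rightarrow> \<phi> (diameter (C j (p div Suc j))))"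
    using C(2,3) by (intro summable_repeated_merge gauge_nonneg[OF g] diameter_ge_0)
  also have "(\<lambda>q. case prod_decode q of (j, p) \<Rightarrow> \<phi> (diameter (C j (p div Suc j)))) = (\<lambda>q. \<phi> (d q))"
    by (auto simp: d_def split: prod.split)
  finally have sum_d: "summable (\<lambda>q. \<phi> (d q))" .

  have "\<forall>q. \<exists>u > d q. \<forall>x. d q < x \<longrightarrow> x < u \<longrightarrow> \<phi> x < \<phi> (d q) + (1 / 2) ^ q"
  proof
    fix q
    show "\<exists>u > d q. \<forall>x. d q < x \<longrightarrow> x < u \<longrightarrow> \<phi> x < \<phi> (d q) + (1 / 2) ^ q"
      by (rule gauge_increase[OF g d_nonneg[of q], of "(1 / 2) ^ q"]) auto
  qed
  then obtain u where u: "\<And>q. d q < u q"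
    "\<And>q x. d q < x \<Longrightarrow> x < u q \<Longrightarrow> \<phi> x < \<phi> (d q) + (1 / 2) ^ q"
    by metis
  (* Distinct enlarged diameters exist because the admissible ranges are nonempty open intervals. *)
  obtain a where a: "inj a" "\<And>q. a q \<in> {d q<..<u q}"
    by (rule injective_choice[of "\<lambda>q. {d q<..<u q}"]) (use u(1) in auto)
  have a_gt: "d q < a q" for q using a(2)[of q] by simp
  have a_pos: "0 < a q" for q using d_nonneg[of q] a_gt[of q] by simp
  have sum_a: "summable (\<lambda>q. \<phi> (a q))"
  proof (rule summable_comparison_test')
    show "summable (\<lambda>q. \<phi> (d q) + (1 / 2) ^ q)"
      using sum_d by (intro summable_add summable_geometric) auto
    show "norm (\<phi> (a q)) \<le> \<phi> (d q) + (1 / 2) ^ q" if "q \<ge> 0" for q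
      using u(2)[of q "a q"] a(2)[of q] gauge_nonneg[OF g, of "a q"] a_pos[of q] by auto
  qed
  have a_lim: "a \<longlonglongrightarrow> 0" by (rule gauge_summable_imp_null[OF g a_pos sum_a])
  obtain \<sigma> :: "nat \<Rightarrow> nat" where \<sigma>: "bij \<sigma>" "strict_antimono_on UNIV (a \<circ> \<sigma>)"
    by (rule decreasing_rearrangement[OF a(1) a_pos a_lim])

  define s where "s = (\<lambda>n. a (\<sigma> (n - 1)))"
  have sum_s: "summable (\<lambda>n. \<phi> (s (Suc n)))"
  proof -
    have "summable ((\<lambda>q. \<phi> (a q)) \<circ> \<sigma>)"
      using sum_a \<sigma>(1) gauge_nonneg[OF g] a_pos
      by (intro summable_reindex) (auto simp: bij_is_inj less_imp_le)
    then show ?thesis by (simp add: s_def o_def)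
  qed
  have s_pos: "0 < s n" for n unfolding s_def by (rule a_pos)
  have s_less: "s n < s m" if "1 \<le> m" "m < n" for m n
    using monotone_onD[OF \<sigma>(2), of "m - 1" "n - 1"] that by (simp add: s_def)
  have s_le: "s n \<le> s m" if "1 \<le> m" "m \<le> n" for m n
    using s_less[of m n] that by (cases "m = n") auto
  have "(\<lambda>n. s (Suc n)) \<longlonglongrightarrow> 0"
    by (rule gauge_summable_imp_null[OF g s_pos sum_s])
  then have s_lim: "s \<longlonglongrightarrow> 0" by (simp add: filterlim_sequentially_Suc)
  have s: "s \<in> null_seqs"
    unfolding null_seqs_def using s_pos s_less s_lim by (auto intro!: monotone_onI)
  have "dominated (dilates s) E"
    unfolding dominated_def
  proof
    fix t assume "t \<in> dilates s"
    then obtain k where k: "k \<ge> 1" "t = dilate s k" by (auto simp: dilates_def)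
    (* The covers are indexed from 0, so the one whose sets own k places has index k - 1. *)
    define j where "j = k - 1"
    have j: "Suc j = k" using k by (simp add: j_def)
    define Q where "Q = (\<lambda>p. inv \<sigma> (prod_encode (j, p)))"
    have "inj Q"
    proof (rule injI)
      fix x y assume "Q x = Q y"
      then have "\<sigma> (Q x) = \<sigma> (Q y)" by simp
      then show "x = y" unfolding Q_def using \<sigma>(1) by (simp add: bij_is_surj surj_f_inv_f)
    qed
    have less: "diameter (C j m) < s (Suc (Q (m * k + i)))" if "i < k" for m i
    proof -
      have "s (Suc (Q (m * k + i))) = a (prod_encode (j, m * k + i))"
        unfolding s_def Q_def using \<sigma>(1) by (simp add: bij_is_surj surj_f_inv_f)
      moreover have "d (prod_encode (j, m * k + i)) = diameter (C j m)"
        using that by (simp add: d_def j)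
      ultimately show ?thesis using a_gt by metis
    qed
    obtain F where "(\<Union>m. C j m) \<subseteq> (\<Union>n\<in>{1..}. F n)"
      "\<And>n. n \<ge> 1 \<Longrightarrow> bounded (F n) \<and> diameter (F n) < s (k * n)"
      by (rule dominated_by_blocks[of k Q s "C j"])
        (use k \<open>inj Q\<close> s_le s_pos C(2) less in auto)
    then show "\<exists>F. E \<subseteq> (\<Union>n\<in>{1..}. F n) \<and> (\<forall>n\<ge>1. bounded (F n) \<and> diameter (F n) < t n)"
      using C(1)[of j] unfolding k(2) dilate_def by (meson order_trans)
  qed
  with s sum_s show ?thesis by blast
qed

section \<open>Dominated sets are null\<close>

text \<open>The first \<open>N * k\<close> terms of \<open>f\<close> split into \<open>N\<close> blocks of length \<open>k\<close>, and the dilated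
  sequence picks the last term of each block, which is its smallest.\<close>

lemma dilated_sum_le:
  fixes f :: "nat \<Rightarrow> real"
  assumes nonneg: "\<And>n. 0 \<le> f (Suc n)" and anti: "\<And>m n. 1 \<le> m \<Longrightarrow> m \<le> n \<Longrightarrow> f n \<le> f m"
    and sum: "summable (\<lambda>n. f (Suc n))" and k: "k \<ge> 1"
  shows "(\<Sum>n<N. f (k * Suc n)) \<le> (\<Sum>n. f (Suc n)) / real k"
proof -
  have "real k * (\<Sum>n<N. f (k * Suc n)) = (\<Sum>n<N. \<Sum>p\<in>{n * k..<n * k + k}. f (k * Suc n))"
    by (simp add: sum_distrib_left)
  also have "\<dots> \<le> (\<Sum>n<N. \<Sum>p\<in>{n * k..<n * k + k}. f (Suc p))"
    by (intro sum_mono anti) (auto simp: algebra_simps)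
  also have "\<dots> = (\<Sum>p<N * k. f (Suc p))" by (rule sum.nat_group)
  also have "\<dots> \<le> (\<Sum>n. f (Suc n))" using sum nonneg by (intro sum_le_suminf) auto
  finally show ?thesis using k by (simp add: field_simps)
qed

lemma dominated_imp_hausdorff_null:
  fixes E :: "'a::metric_space set"
  assumes g: "hausdorff_gauge \<phi>" and s: "s \<in> null_seqs"
    and sum: "summable (\<lambda>n. \<phi> (s (Suc n)))" and dom: "dominated (dilates s) E"
  shows "hausdorff_measure \<phi> E = 0"
proof -
  have s_pos: "0 < s n" if "1 \<le> n" for n using s that by (simp add: null_seqs_def)
  have s_le: "s n \<le> s m" if "1 \<le> m" "m \<le> n" for m n
  proof (cases "m = n")
    case False
    have "strict_antimono_on {1..} s" using s by (simp add: null_seqs_def)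
    from monotone_onD[OF this, of m n] False that show ?thesis by simp
  qed simp
  define B where "B = (\<Sum>n. \<phi> (s (Suc n)))"
  have "(INF C\<in>{C :: nat \<Rightarrow> 'a set. E \<subseteq> (\<Union>n. C n) \<and>
          (\<forall>n. bounded (C n) \<and> diameter (C n) < \<delta>)}.
        (\<Sum>n. ennreal (\<phi> (diameter (C n))))) \<le> 0" (is "?I \<le> 0") if \<delta>: "0 < \<delta>" for \<delta>
  proof (rule ennreal_le_epsilon)
    fix e :: real assume e: "0 < e"
    have "eventually (\<lambda>k. B / real k < e) sequentially"
      using e by (intro order_tendstoD(2)[OF lim_const_over_n])
    moreover have "eventually (\<lambda>k. s k < \<delta>) sequentially"
      using s \<delta> by (intro order_tendstoD(2)[of s 0]) (auto simp: null_seqs_def)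
    ultimately have "eventually (\<lambda>k. B / real k < e \<and> s k < \<delta> \<and> 1 \<le> k) sequentially"
      using eventually_ge_at_top[of 1] by eventually_elim auto
    then obtain k where k: "B / real k < e" "s k < \<delta>" "1 \<le> k"
      using eventually_happens'[OF sequentially_bot] by blast
    have "dilate s k \<in> dilates s" using k(3) by (auto simp: dilates_def)
    then obtain F where F: "E \<subseteq> (\<Union>n\<in>{1..}. F n)"
      "\<And>n. n \<ge> 1 \<Longrightarrow> bounded (F n) \<and> diameter (F n) < s (k * n)"
      using dom unfolding dominated_def dilate_def by metis
    define C where "C = (\<lambda>n. F (Suc n))"
    have C: "bounded (C n)" "diameter (C n) < s (k * Suc n)" for n
      using F(2)[of "Suc n"] by (simp_all add: C_def)
    have "diameter (C n) < \<delta>" for n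
      using C(2)[of n] s_le[of k "k * Suc n"] k by simp
    moreover have "E \<subseteq> (\<Union>n. C n)"
    proof
      fix x assume "x \<in> E"
      then obtain n where "n \<ge> 1" "x \<in> F n" using F(1) by auto
      then have "x \<in> C (n - 1)" by (simp add: C_def)
      then show "x \<in> (\<Union>n. C n)" by blast
    qed
    ultimately have "?I \<le> (\<Sum>n. ennreal (\<phi> (diameter (C n))))"
      using C(1) by (intro INF_lower) auto
    also have "\<dots> \<le> ennreal e"
    proof (rule suminf_le_const)
      fix N
      have "(\<Sum>n<N. ennreal (\<phi> (diameter (C n)))) = ennreal (\<Sum>n<N. \<phi> (diameter (C n)))"
        using g C(1) by (intro sum_ennreal) (auto intro: gauge_nonneg diameter_ge_0)
      also have "\<dots> \<le> ennreal e"
      proof (rule ennreal_leI)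
        have "(\<Sum>n<N. \<phi> (diameter (C n))) \<le> (\<Sum>n<N. \<phi> (s (k * Suc n)))"
          using C by (intro sum_mono gauge_mono[OF g] diameter_ge_0 less_imp_le)
        also have "\<dots> \<le> B / real k"
          unfolding B_def
        proof (rule dilated_sum_le)
          show "0 \<le> \<phi> (s (Suc n))" for n
            using s_pos[of "Suc n"] by (intro gauge_nonneg[OF g]) simp
          show "\<phi> (s n) \<le> \<phi> (s m)" if "1 \<le> m" "m \<le> n" for m n
            using s_pos[of n] s_le[OF that] that by (intro gauge_mono[OF g]) simp_all
        qed (use sum k in auto)
        finally show "(\<Sum>n<N. \<phi> (diameter (C n))) \<le> e" using k(1) by simp
      qed
      finally show "(\<Sum>n<N. ennreal (\<phi> (diameter (C n)))) \<le> ennreal e" .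
    qed simp
    finally show "?I \<le> 0 + ennreal e" by simp
  qed
  then have "hausdorff_measure \<phi> E \<le> 0"
    unfolding hausdorff_measure_def by (intro SUP_least) auto
  then show ?thesis by simp
qed

section \<open>The null ideal as a union of domination ideals\<close>

lemma hausdorff_null_eq:
  assumes "hausdorff_gauge \<phi>"
  shows "(hausdorff_null \<phi> :: 'a::metric_space set set) =
    \<Union>{dominated_sets (dilates s) |s. s \<in> null_seqs \<and> summable (\<lambda>n. \<phi> (s (Suc n)))}"
  (is "_ = ?R")
proof
  show "hausdorff_null \<phi> \<subseteq> ?R"
  proof
    fix E :: "'a set" assume "E \<in> hausdorff_null \<phi>"
    then have "hausdorff_measure \<phi> E = 0" by (simp add: hausdorff_null_def)
    from hausdorff_null_imp_dominated[OF assms this] show "E \<in> ?R"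
      unfolding dominated_sets_def by blast
  qed
  show "?R \<subseteq> hausdorff_null \<phi>"
    unfolding hausdorff_null_def dominated_sets_def
    using dominated_imp_hausdorff_null[OF assms] by blast
qed

theorem theorem4p6:
  fixes \<phi> :: "real \<Rightarrow> real"
  assumes "hausdorff_gauge \<phi>"
  shows "((\<forall>E :: (real ^ 'm) set. hausdorff_measure \<phi> E = 0 \<longrightarrow>
            (\<exists>s\<in>null_seqs. summable (\<lambda>n. \<phi> (s (Suc n))) \<and> dominated (dilates s) E))
          \<and> (hausdorff_null \<phi> :: (real ^ 'm) set set) =
              \<Union>{dominated_sets (dilates s) |s. s \<in> null_seqs \<and> summable (\<lambda>n. \<phi> (s (Suc n)))})
       \<and> ((\<forall>E :: baire set. hausdorff_measure \<phi> E = 0 \<longrightarrow>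
            (\<exists>s\<in>null_seqs. summable (\<lambda>n. \<phi> (s (Suc n))) \<and> dominated (dilates s) E))
          \<and> (hausdorff_null \<phi> :: baire set set) =
              \<Union>{dominated_sets (dilates s) |s. s \<in> null_seqs \<and> summable (\<lambda>n. \<phi> (s (Suc n)))})"
  by (intro conjI allI impI hausdorff_null_imp_dominated hausdorff_null_eq assms)

end
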